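(* Let $(G,\mathbf{1}_V)$ be an unweighted finite connected graph with vertex measure $\mu=\mathbf{1}_V$ satisfying the curvature-dimension inequality $CD(0,\infty)$. Then for any natural number $k$ with $2\le k\le|V|$, $$\mathrm{diam}(G)\le\frac{80e}{e-1}\,d_G\,\log_2|V|\,\frac{k}{\sqrt{\lambda_k(G,\mu)}}.$$
   Context: $G=(V,E)$ is an undirected finite connected graph with adjacency relation $\sim$; unweighted means that all edge weights are $1$. $\mathbf{1}_V$ is the vertex measure $\mu(x)=1$ for all $x\in V$, so the (non-normalized) Laplacian is $\Delta f(x)=\sum_{y,y\sim x}(f(y)-f(x))$ for $f:V\to\mathbb{R}$. The eigenvalues (numbers $\lambda$ such that $\Delta f+\lambda f=0$ has a nonzero solution $f$) are ordered with multiplicity as $0=\lambda_1(G,\mu)<\lambda_2(G,\mu)\le\cdots\le\lambda_{|V|}(G,\mu)$. $d_G$ is the maximal vertex degree of $G$, and $\mathrm{diam}(G)$ is the diameter of $G$ for the shortest-path metric. Define $\Gamma(f,g):=\frac12\{\Delta(fg)-f\Delta g-g\Delta f\}$, $\Gamma_2(f,g):=\frac12\{\Delta\Gamma(f,g)-\Gamma(f,\Delta g)-\Gamma(g,\Delta f)\}$, and $\Gamma_2(f):=\Gamma_2(f,f)$. $(G,\mu)$ satisfies $CD(0,\infty)$ if $\Gamma_2(f)(x)\ge 0$ for all $f:V\to\mathbb{R}$ and all $x\in V$. *)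

theory Defs
  imports "HOL-Analysis.Analysis"
begin

text \<open>
  A finite simple graph is given by a symmetric and irreflexive adjacency relation on a
  finite type of vertices; that type is the whole vertex set.
\<close>

type_synonym 'v adj = "'v \<Rightarrow> 'v \<Rightarrow> bool"

definition connected_graph :: "'v adj \<Rightarrow> bool" where
  "connected_graph E \<longleftrightarrow> (\<forall>x y. E\<^sup>*\<^sup>* x y)"

definition degree :: "'v::finite adj \<Rightarrow> 'v \<Rightarrow> nat" where
  "degree E x = card {y. E x y}"

definition max_degree :: "'v::finite adj \<Rightarrow> nat" where
  "max_degree E = Max (range (degree E))"

text \<open>
  The relational power \<open>E ^^ n\<close> relates the end points of walks of length \<open>n\<close>. The least
  such \<open>n\<close> is only meaningful for vertices in the same connected component.
\<close>

definition graph_dist :: "'v adj \<Rightarrow> 'v \<Rightarrow> 'v \<Rightarrow> nat" where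
  "graph_dist E x y = (LEAST n. (E ^^ n) x y)"

definition graph_diam :: "'v::finite adj \<Rightarrow> nat" where
  "graph_diam E = Max {graph_dist E x y | x y. True}"

definition laplacian :: "'v::finite adj \<Rightarrow> ('v \<Rightarrow> real) \<Rightarrow> 'v \<Rightarrow> real" where
  "laplacian E f x = (\<Sum>y | E x y. f y - f x)"

definition Gamma :: "'v::finite adj \<Rightarrow> ('v \<Rightarrow> real) \<Rightarrow> ('v \<Rightarrow> real) \<Rightarrow> 'v \<Rightarrow> real" where
  "Gamma E f g x =
     1 / 2 * (laplacian E (\<lambda>z. f z * g z) x - f x * laplacian E g x - g x * laplacian E f x)"

definition Gamma2 :: "'v::finite adj \<Rightarrow> ('v \<Rightarrow> real) \<Rightarrow> ('v \<Rightarrow> real) \<Rightarrow> 'v \<Rightarrow> real" where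
  "Gamma2 E f g x =
     1 / 2 * (laplacian E (Gamma E f g) x - Gamma E f (laplacian E g) x - Gamma E g (laplacian E f) x)"

definition CD_0_infinity :: "'v::finite adj \<Rightarrow> bool" where
  "CD_0_infinity E \<longleftrightarrow> (\<forall>f x. Gamma2 E f f x \<ge> 0)"

text \<open>
  Functions on the vertices are taken in \<open>real ^ 'v\<close> here, so that the multiplicity of an
  eigenvalue is the library dimension of its eigenspace. Eigenvalues are those of the
  negative of \<open>laplacian\<close>.
\<close>

definition eigenspace :: "'v::finite adj \<Rightarrow> real \<Rightarrow> (real ^ 'v) set" where
  "eigenspace E l = {f. \<forall>x. laplacian E (\<lambda>z. f $ z) x + l * f $ x = 0}"

definition eigenvalues :: "'v::finite adj \<Rightarrow> real set" where
  "eigenvalues E = {l. \<exists>f \<in> eigenspace E l. f \<noteq> 0}"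

text \<open>
  The eigenvalues in increasing order, each one repeated according to its multiplicity.
  The eigenvalue \<open>\<lambda>\<^sub>k\<close>, counted from \<open>k = 1\<close>, is the list entry with index \<open>k - 1\<close>.
\<close>

definition eigenvalue_list :: "'v::finite adj \<Rightarrow> real list" where
  "eigenvalue_list E =
     concat (map (\<lambda>l. replicate (dim (eigenspace E l)) l) (sorted_list_of_set (eigenvalues E)))"

definition nth_eigenvalue :: "'v::finite adj \<Rightarrow> nat \<Rightarrow> real" where
  "nth_eigenvalue E k = eigenvalue_list E ! (k - 1)"

end

theory Submission
  imports Defs
begin

text \<open>
  The bound comes from an explicit family of test functions, in the manner of Alon and Milman.
  Write \<open>N\<close> for the number of vertices, \<open>d\<close> for the maximal degree and \<open>D\<close> for the diameter. By the
  min-max principle (lemma \<open>nth_eigenvalue_le\<close>), \<open>\<lambda>\<^sub>k \<le> M\<close> as soon as some space of dimension \<open>k\<close>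
  consists of functions with Rayleigh quotient at most \<open>M\<close>. Functions whose supports neither meet
  nor are joined by an edge are orthogonal for the inner product and for the energy, so it is enough
  to find \<open>k\<close> functions of this kind, each with Rayleigh quotient at most \<open>M\<close>.

  A geodesic realising the diameter contains \<open>k\<close> vertices at mutual distance at least \<open>2 R\<close> as
  long as \<open>2 R (k - 1) \<le> D\<close>, and so has room for \<open>k\<close> separated balls of radius \<open>R\<close>, of order
  \<open>D / k\<close>. Cut each
  ball into \<open>m\<close> concentric shells of thickness \<open>s = R / m\<close>, where \<open>m\<close> is \<open>log\<^sub>2 N\<close> rounded up. The
  cardinality of the balls cannot more than double at each of the \<open>m\<close> shells, since it starts from
  at least \<open>1\<close> and never exceeds \<open>N \<le> 2 ^ m\<close>. At a shell where it does not, take the function equal to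
  \<open>s\<close> on the inner ball and decreasing with slope \<open>1\<close> to \<open>0\<close> across the shell: its energy is at most
  \<open>d\<close> times the size of the outer ball, its squared norm at least \<open>s\<^sup>2\<close> times the size of the inner
  one, and so its Rayleigh quotient is at most \<open>2 d / s\<^sup>2\<close> (lemmas \<open>exists_cutoff\<close> and
  \<open>nth_eigenvalue_le_step\<close>).

  With \<open>s\<close> of order \<open>D / (k log\<^sub>2 N)\<close> this bounds \<open>D * sqrt \<lambda>\<^sub>k\<close> by a constant times
  \<open>k * sqrt d * log\<^sub>2 N\<close>. If \<open>D\<close> is too small for an integral \<open>s \<ge> 1\<close>, the trivial bound
  \<open>\<lambda>\<^sub>k \<le> 2 d\<close> takes its place. Division by \<open>sqrt \<lambda>\<^sub>k\<close> is legitimate for \<open>k \<ge> 2\<close> because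
  connectedness makes \<open>0\<close> a simple eigenvalue.
\<close>

section \<open>Counting eigenvalues of a self-adjoint operator\<close>

lemma dim_UN_le:
  fixes A :: "'i \<Rightarrow> 'a::euclidean_space set"
  assumes "finite I"
  shows "dim (span (\<Union>i\<in>I. A i)) \<le> (\<Sum>i\<in>I. dim (A i))"
proof -
  have "\<exists>B. independent B \<and> A i \<subseteq> span B \<and> card B = dim (A i)" for i
    using basis_exists[of "A i"] by metis
  then obtain B where B: "\<And>i. independent (B i)" "\<And>i. A i \<subseteq> span (B i)" "\<And>i. card (B i) = dim (A i)"
    by metis
  have fin: "finite (B i)" for i using B(1) independent_imp_finite by blast
  have "(\<Union>i\<in>I. A i) \<subseteq> span (\<Union>i\<in>I. B i)"
    using B(2) span_mono[of "B _" "\<Union>i\<in>I. B i"] by blast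
  then have "span (\<Union>i\<in>I. A i) \<subseteq> span (\<Union>i\<in>I. B i)"
    by (simp add: span_minimal)
  then have "dim (span (\<Union>i\<in>I. A i)) \<le> card (\<Union>i\<in>I. B i)"
    using fin assms by (intro dim_le_card) auto
  also have "\<dots> \<le> (\<Sum>i\<in>I. dim (A i))"
    using card_UN_le[OF assms, of B] B(3) by simp
  finally show ?thesis .
qed

locale self_adjoint =
  fixes L :: "'a::euclidean_space \<Rightarrow> 'a"
  assumes lin: "linear L"
    and adj: "L x \<bullet> y = x \<bullet> L y"
begin

definition eigsp :: "real \<Rightarrow> 'a set" where
  "eigsp l = {u. L u = l *\<^sub>R u}"

definition spectrum :: "real set" where
  "spectrum = {l. \<exists>u\<in>eigsp l. u \<noteq> 0}"

lemma subspace_eigsp: "subspace (eigsp l)"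
  unfolding subspace_def eigsp_def
  by (auto simp: linear_0[OF lin] linear_add[OF lin] linear_scale[OF lin] scaleR_add_right)

lemma eigsp_orthogonal:
  assumes "u \<in> eigsp l" "v \<in> eigsp l'" "l \<noteq> l'"
  shows "u \<bullet> v = 0"
proof -
  have "l * (u \<bullet> v) = l' * (u \<bullet> v)"
    using adj[of u v] assms(1,2) by (simp add: eigsp_def)
  then show ?thesis using assms(3) by simp
qed

lemma finite_spectrum: "finite spectrum"
proof -
  define e where "e l = (SOME u. u \<in> eigsp l \<and> u \<noteq> 0)" for l
  have e: "e l \<in> eigsp l" "e l \<noteq> 0" if "l \<in> spectrum" for l
  proof -
    have "\<exists>u. u \<in> eigsp l \<and> u \<noteq> 0" using that by (auto simp: spectrum_def)
    then have "e l \<in> eigsp l \<and> e l \<noteq> 0" unfolding e_def by (rule someI_ex)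
    then show "e l \<in> eigsp l" "e l \<noteq> 0" by auto
  qed
  have orth: "e l \<bullet> e l' = 0" if "l \<in> spectrum" "l' \<in> spectrum" "l \<noteq> l'" for l l'
    using eigsp_orthogonal e that by blast
  have "inj_on e spectrum"
    by (rule inj_onI) (metis e(2) inner_eq_zero_iff orth)
  moreover have "independent (e ` spectrum)"
    using orth e(2) by (intro pairwise_orthogonal_independent) (auto simp: pairwise_def orthogonal_def)
  ultimately show ?thesis
    using independent_imp_finite finite_imageD by blast
qed

text \<open>
  The witness minimises the Rayleigh quotient over the unit sphere of the invariant subspace. It is
  an eigenvector since the residual \<open>L u - l u\<close> stays inside the subspace and can be used as a
  direction of variation.
\<close>

lemma exists_eigenvector:
  assumes S: "subspace S" "\<And>u. u \<in> S \<Longrightarrow> L u \<in> S"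
    and f: "f \<in> S" "f \<noteq> 0" "L f \<bullet> f \<le> M * (f \<bullet> f)"
  shows "\<exists>l\<le>M. \<exists>u\<in>S. u \<noteq> 0 \<and> u \<in> eigsp l"
proof -
  have comp: "compact (S \<inter> sphere 0 1)"
    using S(1) by (simp add: closed_subspace compact_Int_closed Int_commute[of S])
  have homog: "L (c *\<^sub>R v) \<bullet> (c *\<^sub>R v) = c\<^sup>2 * (L v \<bullet> v)" for c v
    by (simp add: linear_scale[OF lin] power2_eq_square)
  define f' where "f' = (1 / norm f) *\<^sub>R f"
  have f': "f' \<in> S \<inter> sphere 0 1"
    using f S(1) by (simp add: f'_def subspace_scale)
  have cont: "continuous_on (S \<inter> sphere 0 1) (\<lambda>u. L u \<bullet> u)"
    using lin by (intro continuous_intros linear_continuous_on) (simp add: linear_conv_bounded_linear)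
  obtain u where u: "u \<in> S" "norm u = 1"
    and umin: "\<And>v. v \<in> S \<inter> sphere 0 1 \<Longrightarrow> L u \<bullet> u \<le> L v \<bullet> v"
    using continuous_attains_inf[OF comp _ cont] f' by (metis IntD1 IntD2 empty_iff mem_sphere_0)
  define l where "l = L u \<bullet> u"
  have "l \<le> L f' \<bullet> f'" using umin[OF f'] by (simp add: l_def)
  also have "\<dots> = (L f \<bullet> f) / (f \<bullet> f)"
    unfolding f'_def homog by (simp add: power_divide power2_norm_eq_inner)
  also have "\<dots> \<le> M" using f by (simp add: divide_le_eq)
  finally have "l \<le> M" .
  have ge: "l * (v \<bullet> v) \<le> L v \<bullet> v" if "v \<in> S" for v
  proof (cases "v = 0")
    case True then show ?thesis by simp
  next
    case False
    have "l \<le> L ((1 / norm v) *\<^sub>R v) \<bullet> ((1 / norm v) *\<^sub>R v)"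
      unfolding l_def using that False S(1) by (intro umin) (simp add: subspace_scale)
    also have "\<dots> = (L v \<bullet> v) / (v \<bullet> v)"
      unfolding homog by (simp add: power_divide power2_norm_eq_inner)
    finally show ?thesis using False by (simp add: le_divide_eq)
  qed
  define w where "w = L u - l *\<^sub>R u"
  have wS: "w \<in> S" unfolding w_def using S u by (simp add: subspace_diff subspace_scale)
  define c where "c = L w \<bullet> w - l * (w \<bullet> w)"
  have c0: "c \<ge> 0" using ge[OF wS] by (simp add: c_def)
  have uw: "L u \<bullet> w - l * (u \<bullet> w) = w \<bullet> w"
    by (simp add: w_def inner_diff_left inner_diff_right inner_commute[of u "L u"])
  have uu: "u \<bullet> u = 1" using u(2) by (simp add: norm_eq_1)
  \<comment> \<open>First variation of the quadratic form at the minimiser in the direction of its residual.\<close>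
  have var: "0 \<le> 2 * t * (w \<bullet> w) + t\<^sup>2 * c" for t
  proof -
    have "l * ((u + t *\<^sub>R w) \<bullet> (u + t *\<^sub>R w)) \<le> L (u + t *\<^sub>R w) \<bullet> (u + t *\<^sub>R w)"
      by (intro ge) (simp add: S u wS subspace_add subspace_scale)
    moreover have "L (u + t *\<^sub>R w) \<bullet> (u + t *\<^sub>R w) = l + 2 * t * (L u \<bullet> w) + t\<^sup>2 * (L w \<bullet> w)"
      using adj[of w u] by (simp add: linear_add[OF lin] linear_scale[OF lin] inner_add_left
          inner_add_right l_def power2_eq_square inner_commute[of w "L u"] distrib_left)
    moreover have "(u + t *\<^sub>R w) \<bullet> (u + t *\<^sub>R w) = 1 + 2 * t * (u \<bullet> w) + t\<^sup>2 * (w \<bullet> w)"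
      using uu by (simp add: inner_add_left inner_add_right power2_eq_square inner_commute[of w u] distrib_left)
    ultimately have "l * (1 + 2 * t * (u \<bullet> w) + t\<^sup>2 * (w \<bullet> w))
        \<le> l + 2 * t * (L u \<bullet> w) + t\<^sup>2 * (L w \<bullet> w)"
      by simp
    then have "0 \<le> 2 * t * (L u \<bullet> w - l * (u \<bullet> w)) + t\<^sup>2 * c"
      by (simp add: c_def algebra_simps)
    then show ?thesis by (simp add: uw)
  qed
  have "w \<bullet> w = 0"
  proof -
    define t where "t = - (w \<bullet> w) / (c + 1)"
    have t: "t * (c + 1) = - (w \<bullet> w)" using c0 by (simp add: t_def)
    have "2 * t * (w \<bullet> w) + t\<^sup>2 * c = - t\<^sup>2 * (c + 2)"
    proof -
      have "w \<bullet> w = - (t * (c + 1))" using t by simp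
      then show ?thesis by (simp only:) (simp add: power2_eq_square algebra_simps)
    qed
    then have "t\<^sup>2 * (c + 2) \<le> 0" using var[of t] by simp
    then have "t = 0" using c0 by (simp add: mult_le_0_iff)
    then show ?thesis using t by simp
  qed
  then have "u \<in> eigsp l" by (simp add: w_def eigsp_def)
  then show ?thesis using \<open>l \<le> M\<close> u by (metis norm_zero zero_neq_one)
qed

text \<open>
  This is the half of the min-max principle that bounds eigenvalues from above. It avoids
  diagonalising \<open>L\<close>: if the eigenvectors with eigenvalue at most \<open>M\<close> spanned too small a space \<open>U\<close>,
  some nonzero vector of \<open>W\<close> would lie in the invariant complement of \<open>U\<close>, which would then contain
  a further eigenvector with eigenvalue at most \<open>M\<close>. With \<open>W\<close> the whole space it also shows that
  the multiplicities of all eigenvalues add up to at least the dimension.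
\<close>

lemma dim_le_count_eigenvalues:
  assumes W: "subspace W" and M: "\<And>f. f \<in> W \<Longrightarrow> L f \<bullet> f \<le> M * (f \<bullet> f)"
  shows "dim W \<le> (\<Sum>l | l \<in> spectrum \<and> l \<le> M. dim (eigsp l))"
proof (rule ccontr)
  define I where "I = {l. l \<in> spectrum \<and> l \<le> M}"
  define U where "U = span (\<Union>l\<in>I. eigsp l)"
  define P where "P = {y \<in> UNIV. \<forall>x\<in>U. orthogonal x y}"
  assume "\<not> ?thesis"
  then have "dim U < dim W"
    using dim_UN_le[of I eigsp] finite_spectrum by (simp add: U_def I_def)
  moreover have "dim P + dim U = DIM('a)"
    using dim_subspace_orthogonal_to_vectors[of U UNIV] by (simp add: P_def U_def)
  moreover have subP: "subspace P"
    by (simp add: P_def subspace_orthogonal_to_vectors)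
  moreover have "dim {x + y |x y. x \<in> W \<and> y \<in> P} + dim (W \<inter> P) = dim W + dim P"
    by (rule dim_sums_Int[OF W subP])
  moreover have "dim {x + y |x y. x \<in> W \<and> y \<in> P} \<le> DIM('a)"
    by (rule dim_subset_UNIV)
  ultimately have "dim (W \<inter> P) \<noteq> 0" by linarith
  then obtain f where f: "f \<in> W" "f \<in> P" "f \<noteq> 0"
    by (auto simp: dim_eq_0)
  have U_inv: "L x \<in> U" if "x \<in> U" for x
    using that unfolding U_def
  proof (induction rule: span_induct_alt)
    case base then show ?case by (simp add: linear_0[OF lin] span_zero)
  next
    case (step c x y)
    then obtain l where "l \<in> I" "x \<in> eigsp l" by blast
    then have "L x = l *\<^sub>R x" and "x \<in> span (\<Union>l\<in>I. eigsp l)"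
      by (auto simp: eigsp_def intro: span_base)
    then have "L x \<in> span (\<Union>l\<in>I. eigsp l)" by (simp add: span_scale)
    then show ?case using step by (simp add: linear_add[OF lin] linear_scale[OF lin] span_add span_scale)
  qed
  have P_inv: "L y \<in> P" if "y \<in> P" for y
    using that U_inv by (simp add: P_def orthogonal_def adj[symmetric])
  obtain l u where lu: "l \<le> M" "u \<in> P" "u \<noteq> 0" "u \<in> eigsp l"
    using exists_eigenvector[OF subP P_inv f(2,3) M[OF f(1)]] by blast
  then have "u \<in> U" unfolding U_def I_def by (intro span_base) (auto simp: spectrum_def)
  then have "u \<bullet> u = 0" using lu(2) by (simp add: P_def orthogonal_def)
  then show False using lu(3) by simp
qed

text \<open>
  Orthogonality for both forms makes them simultaneously diagonal on \<open>B\<close>, so a bound on the Rayleigh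
  quotients of the generators passes to the whole span without loss.
\<close>

lemma rayleigh_span:
  assumes "finite B" and orth: "\<And>u v. u \<in> B \<Longrightarrow> v \<in> B \<Longrightarrow> u \<noteq> v \<Longrightarrow> u \<bullet> v = 0"
    and Lorth: "\<And>u v. u \<in> B \<Longrightarrow> v \<in> B \<Longrightarrow> u \<noteq> v \<Longrightarrow> L u \<bullet> v = 0"
    and bound: "\<And>u. u \<in> B \<Longrightarrow> L u \<bullet> u \<le> M * (u \<bullet> u)"
    and f: "f \<in> span B"
  shows "L f \<bullet> f \<le> M * (f \<bullet> f)"
proof -
  obtain c where c: "f = (\<Sum>v\<in>B. c v *\<^sub>R v)"
    using f by (auto simp: span_finite[OF assms(1)])
  have diag: "(\<Sum>u\<in>B. \<Sum>v\<in>B. c u * (c v * g u v)) = (\<Sum>u\<in>B. (c u)\<^sup>2 * g u u)"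
    if "\<And>u v. u \<in> B \<Longrightarrow> v \<in> B \<Longrightarrow> u \<noteq> v \<Longrightarrow> g u v = 0" for g :: "'a \<Rightarrow> 'a \<Rightarrow> real"
  proof (rule sum.cong[OF refl])
    fix u assume u: "u \<in> B"
    have "(\<Sum>v\<in>B. c u * (c v * g u v)) = (\<Sum>v\<in>{u}. c u * (c v * g u v))"
      using that u assms(1) by (intro sum.mono_neutral_right) auto
    then show "(\<Sum>v\<in>B. c u * (c v * g u v)) = (c u)\<^sup>2 * g u u"
      by (simp add: power2_eq_square)
  qed
  have "L f \<bullet> f = (\<Sum>u\<in>B. \<Sum>v\<in>B. c u * (c v * (L u \<bullet> v)))"
    unfolding c
    by (simp add: linear_sum[OF lin] linear_scale[OF lin] inner_sum_left inner_sum_right sum_distrib_left)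
      (subst sum.swap, simp add: mult.left_commute)
  also have "\<dots> = (\<Sum>u\<in>B. (c u)\<^sup>2 * (L u \<bullet> u))" by (rule diag[OF Lorth])
  also have "\<dots> \<le> (\<Sum>u\<in>B. (c u)\<^sup>2 * (M * (u \<bullet> u)))"
    using bound by (intro sum_mono mult_left_mono) auto
  also have "\<dots> = M * (\<Sum>u\<in>B. (c u)\<^sup>2 * (u \<bullet> u))"
    by (simp add: sum_distrib_left mult_ac)
  also have "(\<Sum>u\<in>B. (c u)\<^sup>2 * (u \<bullet> u)) = (\<Sum>u\<in>B. \<Sum>v\<in>B. c u * (c v * (u \<bullet> v)))"
    by (rule diag[OF orth, symmetric])
  also have "\<dots> = f \<bullet> f"
    unfolding c
    by (simp add: inner_sum_left inner_sum_right sum_distrib_left)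
      (subst sum.swap, simp add: mult.left_commute)
  finally show ?thesis .
qed

end

lemma sorted_concat_replicate:
  "sorted xs \<Longrightarrow> sorted (concat (map (\<lambda>l. replicate (c l) l) xs))"
  by (induction xs) (auto simp: sorted_append)

lemma length_filter_concat_replicate:
  assumes "distinct xs"
  shows "length (filter P (concat (map (\<lambda>l. replicate (c l) l) xs))) = (\<Sum>l | l \<in> set xs \<and> P l. c l)"
proof -
  have "length (filter P (concat (map (\<lambda>l. replicate (c l) l) xs)))
      = sum_list (map (\<lambda>l. if P l then c l else 0) xs)"
    by (induction xs) auto
  also have "\<dots> = (\<Sum>l\<in>set xs. if P l then c l else 0)"
    using assms by (simp add: sum_list_distinct_conv_sum_set)
  also have "\<dots> = (\<Sum>l | l \<in> set xs \<and> P l. c l)"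
    by (simp add: sum.inter_filter)
  finally show ?thesis .
qed

text \<open>
  Turns counting with multiplicity into information about the \<open>k\<close>-th entry of the sorted list; it
  gives upper bounds for \<open>\<lambda>\<^sub>k\<close> in one direction and its positivity in the other.
\<close>

lemma sorted_nth_le_iff:
  fixes xs :: "'a::linorder list"
  assumes "sorted xs" "i < length xs"
  shows "xs ! i \<le> M \<longleftrightarrow> i < length (filter (\<lambda>x. x \<le> M) xs)"
proof
  assume le: "xs ! i \<le> M"
  have "{..i} \<subseteq> {j. j < length xs \<and> xs ! j \<le> M}"
    using assms le by (auto intro: order_trans[OF sorted_nth_mono])
  from card_mono[OF _ this] show "i < length (filter (\<lambda>x. x \<le> M) xs)"
    by (simp add: length_filter_conv_card Suc_le_eq)
next
  assume lt: "i < length (filter (\<lambda>x. x \<le> M) xs)"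
  show "xs ! i \<le> M"
  proof (rule ccontr)
    assume not: "\<not> xs ! i \<le> M"
    have "{j. j < length xs \<and> xs ! j \<le> M} \<subseteq> {..<i}"
      using assms not by (auto simp: not_le) (metis leD le_less_trans linorder_not_le sorted_nth_mono)
    from card_mono[OF _ this] show False
      using lt by (simp add: length_filter_conv_card)
  qed
qed

section \<open>The Laplacian as a self-adjoint operator\<close>

definition neg_laplacian :: "'v::finite adj \<Rightarrow> real ^ 'v \<Rightarrow> real ^ 'v" where
  "neg_laplacian E f = (\<chi> x. - laplacian E (\<lambda>z. f $ z) x)"

lemma neg_laplacian_nth: "neg_laplacian E f $ x = (\<Sum>y | E x y. f $ x - f $ y)"
  by (simp add: neg_laplacian_def laplacian_def flip: sum_negf)

lemma linear_neg_laplacian: "linear (neg_laplacian E)"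
proof (rule linearI)
  show "neg_laplacian E (f + g) = neg_laplacian E f + neg_laplacian E g" for f g
    by (simp add: vec_eq_iff neg_laplacian_nth add_diff_add sum.distrib)
  show "neg_laplacian E (c *\<^sub>R f) = c *\<^sub>R neg_laplacian E f" for c f
    by (simp add: vec_eq_iff neg_laplacian_nth sum_distrib_left right_diff_distrib)
qed

text \<open>
  Summation by parts. Each edge occurs twice in the double sum over ordered pairs, whence the
  factor \<open>1 / 2\<close>.
\<close>

lemma energy:
  assumes "symp E"
  shows "neg_laplacian E f \<bullet> g
    = 1 / 2 * (\<Sum>x\<in>UNIV. \<Sum>y\<in>UNIV. of_bool (E x y) * ((f $ x - f $ y) * (g $ x - g $ y)))"
proof -
  define h where "h x y = of_bool (E x y) * ((f $ x - f $ y) * g $ x)" for x y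
  have "neg_laplacian E f \<bullet> g = (\<Sum>x\<in>UNIV. \<Sum>y\<in>UNIV. h x y)"
    by (simp add: inner_vec_def neg_laplacian_nth h_def sum_distrib_right)
  moreover have "(\<Sum>x\<in>UNIV. \<Sum>y\<in>UNIV. h x y) = (\<Sum>x\<in>UNIV. \<Sum>y\<in>UNIV. h y x)"
    by (rule sum.swap)
  ultimately have "neg_laplacian E f \<bullet> g = 1 / 2 * (\<Sum>x\<in>UNIV. \<Sum>y\<in>UNIV. h x y + h y x)"
    by (simp add: sum.distrib)
  also have "(\<lambda>x y. h x y + h y x)
      = (\<lambda>x y. of_bool (E x y) * ((f $ x - f $ y) * (g $ x - g $ y)))"
    using sympD[OF assms] by (auto simp: h_def fun_eq_iff algebra_simps)
  finally show ?thesis .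
qed

lemma self_adjoint_neg_laplacian:
  assumes "symp E"
  shows "self_adjoint (neg_laplacian E)"
proof (rule self_adjoint.intro)
  show "linear (neg_laplacian E)" by (rule linear_neg_laplacian)
  show "neg_laplacian E x \<bullet> y = x \<bullet> neg_laplacian E y" for x y
    by (simp add: inner_commute[of x] energy[OF assms] mult.commute)
qed

lemma eigsp_neg_laplacian:
  assumes "symp E"
  shows "self_adjoint.eigsp (neg_laplacian E) l = eigenspace E l"
  by (simp add: self_adjoint.eigsp_def[OF self_adjoint_neg_laplacian[OF assms]] eigenspace_def
      neg_laplacian_def vec_eq_iff neg_eq_iff_add_eq_0)

lemma spectrum_neg_laplacian:
  assumes "symp E"
  shows "self_adjoint.spectrum (neg_laplacian E) = eigenvalues E"
  by (simp add: self_adjoint.spectrum_def[OF self_adjoint_neg_laplacian[OF assms]] eigenvalues_def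
      eigsp_neg_laplacian[OF assms])

lemma finite_eigenvalues: "symp E \<Longrightarrow> finite (eigenvalues E)"
  using self_adjoint.finite_spectrum[OF self_adjoint_neg_laplacian, of E] by (simp add: spectrum_neg_laplacian)

lemma sorted_eigenvalue_list: "sorted (eigenvalue_list E)"
  unfolding eigenvalue_list_def by (rule sorted_concat_replicate) simp

lemma length_filter_eigenvalue_list:
  assumes "symp E"
  shows "length (filter P (eigenvalue_list E)) = (\<Sum>l | l \<in> eigenvalues E \<and> P l. dim (eigenspace E l))"
  using finite_eigenvalues[OF assms]
  by (simp add: eigenvalue_list_def length_filter_concat_replicate)

text \<open>
  The first conclusion matters because list indexing beyond the end yields an unspecified value.
\<close>

lemma nth_eigenvalue_le:
  assumes "symp E" and "subspace W" and "1 \<le> k" "k \<le> dim W"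
    and "\<And>f. f \<in> W \<Longrightarrow> neg_laplacian E f \<bullet> f \<le> M * (f \<bullet> f)"
  shows "k \<le> length (eigenvalue_list E)" and "nth_eigenvalue E k \<le> M"
proof -
  have "k \<le> length (filter (\<lambda>l. l \<le> M) (eigenvalue_list E))"
    using self_adjoint.dim_le_count_eigenvalues[OF self_adjoint_neg_laplacian[OF assms(1)] assms(2,5)] assms(1,4)
    by (simp add: length_filter_eigenvalue_list spectrum_neg_laplacian eigsp_neg_laplacian)
  moreover from this show "k \<le> length (eigenvalue_list E)"
    using length_filter_le order_trans by blast
  ultimately show "nth_eigenvalue E k \<le> M"
    using assms(3) by (simp add: nth_eigenvalue_def sorted_nth_le_iff[OF sorted_eigenvalue_list])
qed

lemma degree_le_max_degree: "degree E x \<le> max_degree E"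
  unfolding max_degree_def by (rule Max_ge) auto

lemma sum_of_bool_adj: "(\<Sum>y\<in>UNIV. of_bool (E x y)) = real (degree E x)"
  by (simp add: degree_def)

lemma sum_edges_endpoints_le:
  fixes w :: "'v::finite \<Rightarrow> real"
  assumes "symp E" "\<And>x. 0 \<le> w x"
  shows "(\<Sum>x\<in>UNIV. \<Sum>y\<in>UNIV. of_bool (E x y) * (w x + w y)) \<le> 2 * (real (max_degree E) * (\<Sum>x\<in>UNIV. w x))"
proof -
  have eq: "(\<Sum>x\<in>UNIV. \<Sum>y\<in>UNIV. of_bool (E x y) * w x) = (\<Sum>x\<in>UNIV. degree E x * w x)"
    by (simp add: sum_distrib_right[symmetric] sum_of_bool_adj)
  have "(\<Sum>x\<in>UNIV. \<Sum>y\<in>UNIV. of_bool (E x y) * w y) = (\<Sum>x\<in>UNIV. \<Sum>y\<in>UNIV. of_bool (E x y) * w x)"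
    using sympD[OF assms(1)] by (subst sum.swap) (intro sum.cong refl, auto)
  then have "(\<Sum>x\<in>UNIV. \<Sum>y\<in>UNIV. of_bool (E x y) * (w x + w y)) = 2 * (\<Sum>x\<in>UNIV. degree E x * w x)"
    unfolding distrib_left sum.distrib eq by (simp only: eq mult_2)
  also have "\<dots> \<le> 2 * (\<Sum>x\<in>UNIV. real (max_degree E) * w x)"
    using assms(2) degree_le_max_degree by (intro mult_left_mono sum_mono mult_right_mono) auto
  finally show ?thesis by (simp add: sum_distrib_left)
qed

lemma energy_le_max_degree:
  assumes "symp E"
  shows "neg_laplacian E f \<bullet> f \<le> 2 * real (max_degree E) * (f \<bullet> f)"
proof -
  have "neg_laplacian E f \<bullet> f
      \<le> 1 / 2 * (\<Sum>x\<in>UNIV. \<Sum>y\<in>UNIV. of_bool (E x y) * (2 * (f $ x)\<^sup>2 + 2 * (f $ y)\<^sup>2))"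
    unfolding energy[OF assms]
  proof (intro mult_left_mono sum_mono)
    fix x y
    have "0 \<le> (f $ x + f $ y)\<^sup>2" by simp
    then show "(f $ x - f $ y) * (f $ x - f $ y) \<le> 2 * (f $ x)\<^sup>2 + 2 * (f $ y)\<^sup>2"
      by (simp add: power2_eq_square algebra_simps)
  qed auto
  also have "\<dots> \<le> 1 / 2 * (2 * (real (max_degree E) * (\<Sum>x\<in>UNIV. 2 * (f $ x)\<^sup>2)))"
    by (intro mult_left_mono sum_edges_endpoints_le[OF assms]) auto
  also have "\<dots> = 2 * real (max_degree E) * (f \<bullet> f)"
    by (simp add: inner_vec_def power2_eq_square flip: sum_distrib_left)
  finally show ?thesis .
qed

lemma card_le_length_eigenvalue_list:
  assumes "symp (E :: 'v::finite adj)"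
  shows "CARD('v) \<le> length (eigenvalue_list E)"
  by (rule nth_eigenvalue_le(1)[OF assms subspace_UNIV _ _ energy_le_max_degree[OF assms]])
    (simp_all add: dim_UNIV Suc_le_eq)

text \<open>
  An edge contributes at most \<open>1\<close>, and only if one of its end points lies in the support; each
  vertex of the support accounts for at most \<open>max_degree E\<close> such edges.
\<close>

lemma energy_le_support:
  assumes "symp E" and lip: "\<And>x y. E x y \<Longrightarrow> \<bar>f $ x - f $ y\<bar> \<le> 1"
  shows "neg_laplacian E f \<bullet> f \<le> real (max_degree E) * real (card {x. f $ x \<noteq> 0})"
proof -
  have "neg_laplacian E f \<bullet> f
      \<le> 1 / 2 * (\<Sum>x\<in>UNIV. \<Sum>y\<in>UNIV. of_bool (E x y) * (of_bool (f $ x \<noteq> 0) + of_bool (f $ y \<noteq> 0)))"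
    unfolding energy[OF assms(1)]
  proof (rule mult_left_mono[OF sum_mono[OF sum_mono]])
    fix x y
    have "(f $ x - f $ y) * (f $ x - f $ y) \<le> 1" if "E x y"
      using power_mono[OF lip[OF that], of 2] by (simp add: power2_eq_square)
    then show "of_bool (E x y) * ((f $ x - f $ y) * (f $ x - f $ y))
        \<le> of_bool (E x y) * (of_bool (f $ x \<noteq> 0) + of_bool (f $ y \<noteq> 0))"
      by (cases "f $ x = 0"; cases "f $ y = 0") auto
  qed auto
  also have "\<dots> \<le> 1 / 2 * (2 * (real (max_degree E) * (\<Sum>x\<in>UNIV. of_bool (f $ x \<noteq> 0))))"
    by (intro mult_left_mono sum_edges_endpoints_le[OF assms(1)]) auto
  also have "\<dots> = real (max_degree E) * real (card {x. f $ x \<noteq> 0})" by simp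
  finally show ?thesis .
qed

text \<open>
  The energy is a sum of squares over the edges; if it is not positive, the function is constant
  along edges and hence on the connected graph.
\<close>

lemma eigenspace_nonpos:
  assumes "symp E" "connected_graph E" "l \<le> 0" "f \<in> eigenspace E l"
  shows "\<exists>c. f = c *\<^sub>R 1"
proof -
  have "neg_laplacian E f = l *\<^sub>R f"
    using assms(4) by (simp add: eigenspace_def neg_laplacian_def vec_eq_iff neg_eq_iff_add_eq_0)
  then have "neg_laplacian E f \<bullet> f \<le> 0"
    using assms(3) by (simp add: mult_nonpos_nonneg)
  moreover have nn: "0 \<le> of_bool (E x y) * ((f $ x - f $ y) * (f $ x - f $ y))" for x y
    by simp
  ultimately have "(\<Sum>x\<in>UNIV. \<Sum>y\<in>UNIV. of_bool (E x y) * ((f $ x - f $ y) * (f $ x - f $ y))) = 0"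
    unfolding energy[OF assms(1)] by (intro order.antisym sum_nonneg) auto
  then have zero: "of_bool (E x y) * ((f $ x - f $ y) * (f $ x - f $ y)) = 0" for x y
    using nn by (simp add: sum_nonneg_eq_0_iff sum_nonneg)
  have edge: "f $ x = f $ y" if "E x y" for x y
    using zero[of x y] that by simp
  have const: "f $ x = f $ y" for x y
  proof -
    have "E\<^sup>*\<^sup>* x y" using assms(2) by (simp add: connected_graph_def)
    then show ?thesis
    proof (induction rule: rtranclp_induct)
      case (step y z)
      then show ?case using edge[of y z] by simp
    qed simp
  qed
  have "f $ x = ((f $ undefined) *\<^sub>R 1) $ x" for x
    using const[of x undefined] by simp
  then have "f = (f $ undefined) *\<^sub>R 1" unfolding vec_eq_iff by blast
  then show ?thesis by blast
qed

lemma nth_eigenvalue_pos: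
  fixes E :: "'v::finite adj"
  assumes "symp E" "connected_graph E" "2 \<le> k" "k \<le> length (eigenvalue_list E)"
  shows "0 < nth_eigenvalue E k"
proof (rule ccontr)
  assume "\<not> ?thesis"
  then have "k - 1 < length (filter (\<lambda>l. l \<le> 0) (eigenvalue_list E))"
    using assms(3,4) by (simp add: nth_eigenvalue_def not_less flip: sorted_nth_le_iff[OF sorted_eigenvalue_list])
  then have "2 \<le> length (filter (\<lambda>l. l \<le> 0) (eigenvalue_list E))" using assms(3) by linarith
  also have "\<dots> = (\<Sum>l | l \<in> eigenvalues E \<and> l \<le> 0. dim (eigenspace E l))"
    by (rule length_filter_eigenvalue_list[OF assms(1)])
  also have "\<dots> \<le> (\<Sum>l\<in>{0}. dim (eigenspace E l))"
  proof (rule sum_mono2)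
    show "{l \<in> eigenvalues E. l \<le> 0} \<subseteq> {0}"
    proof
      fix l assume "l \<in> {l \<in> eigenvalues E. l \<le> 0}"
      then obtain f where l: "l \<le> 0" and f: "f \<in> eigenspace E l" "f \<noteq> 0"
        by (auto simp: eigenvalues_def)
      obtain c where c: "f = c *\<^sub>R 1" using eigenspace_nonpos[OF assms(1,2) l f(1)] by blast
      then have "l * c = 0" "c \<noteq> 0" using f by (auto simp: eigenspace_def laplacian_def)
      then show "l \<in> {0}" by simp
    qed
  qed auto
  also have "\<dots> \<le> 1"
  proof -
    have "f \<in> span {1}" if f: "f \<in> eigenspace E 0" for f
      using eigenspace_nonpos[OF assms(1,2) order_refl f] by (auto intro: span_scale span_base)
    then have "eigenspace E 0 \<subseteq> span {1}" by blast
    then have "dim (eigenspace E 0) \<le> card {1 :: real ^ 'v}" by (rule dim_le_card) simp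
    then show ?thesis by simp
  qed
  finally show False by simp
qed

section \<open>Graph distance\<close>

lemma relpowp_graph_dist:
  assumes "connected_graph E"
  shows "(E ^^ graph_dist E x y) x y"
proof -
  have "E\<^sup>*\<^sup>* x y" using assms by (simp add: connected_graph_def)
  then obtain n where "(E ^^ n) x y" by (blast dest: rtranclp_imp_relpowp)
  then show ?thesis unfolding graph_dist_def by (rule LeastI)
qed

lemma graph_dist_le: "(E ^^ n) x y \<Longrightarrow> graph_dist E x y \<le> n"
  unfolding graph_dist_def by (rule Least_le)

lemma graph_dist_self: "graph_dist E x x = 0"
  using graph_dist_le[of 0 E x x] by simp

lemma graph_dist_triangle:
  assumes "connected_graph E"
  shows "graph_dist E x z \<le> graph_dist E x y + graph_dist E y z"
  using relpowp_trans[OF relpowp_graph_dist[OF assms] relpowp_graph_dist[OF assms]]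
  by (rule graph_dist_le)

lemma graph_dist_edge: "E x y \<Longrightarrow> graph_dist E x y \<le> 1"
  by (rule graph_dist_le) (simp only: relpowp_1)

lemma relpowp_sym:
  assumes "symp E"
  shows "(E ^^ n) x y \<Longrightarrow> (E ^^ n) y x"
proof (induction n arbitrary: y)
  case 0 then show ?case by simp
next
  case (Suc n)
  then obtain z where "(E ^^ n) x z" "E z y" by auto
  then show ?case using Suc.IH sympD[OF assms] relpowp_Suc_I2 by metis
qed

lemma graph_dist_sym: "symp E \<Longrightarrow> graph_dist E x y = graph_dist E y x"
  unfolding graph_dist_def by (metis relpowp_sym)

text \<open>
  The witness is the \<open>t\<close>-th vertex of a geodesic from \<open>x\<close> to \<open>y\<close>.
\<close>

lemma exists_at_distance:
  assumes "connected_graph E" "t \<le> graph_dist E x y"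
  shows "\<exists>z. graph_dist E x z = t"
proof -
  define n where "n = graph_dist E x y - t"
  have n: "t + n = graph_dist E x y" using assms(2) by (simp add: n_def)
  have "(E ^^ (t + n)) x y"
    using relpowp_graph_dist[OF assms(1), of x y] by (simp only: n)
  then have "(E ^^ t OO E ^^ n) x y"
    by (subst (asm) relpowp_add)
  then obtain z where z: "(E ^^ t) x z" "(E ^^ n) z y"
    by (rule relcomppE)
  have "graph_dist E x y \<le> graph_dist E x z + n"
    using graph_dist_triangle[OF assms(1), of x y z] graph_dist_le[OF z(2)] by linarith
  then have "graph_dist E x z = t" using graph_dist_le[OF z(1)] n by linarith
  then show ?thesis ..
qed

lemma graph_diam_attained: "\<exists>x y. graph_dist E x y = graph_diam (E :: 'v::finite adj)"
proof -
  have "{graph_dist E x y |x y. True} = (\<lambda>(x, y). graph_dist E x y) ` UNIV" by auto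
  then have "graph_diam E \<in> {graph_dist E x y |x y. True}"
    unfolding graph_diam_def by (intro Max_in) auto
  then show ?thesis by (smt (verit) mem_Collect_eq)
qed

section \<open>Test functions on balls\<close>

text \<open>
  If every step more than doubled \<open>b\<close>, then \<open>b m\<close> would exceed \<open>2 ^ m\<close>.
\<close>

lemma exists_non_doubling_step:
  fixes b :: "nat \<Rightarrow> nat"
  assumes "1 \<le> b 0" "b m \<le> 2 ^ m" "1 \<le> m"
  shows "\<exists>j<m. b (Suc j) \<le> 2 * b j"
proof (rule ccontr)
  assume "\<not> ?thesis"
  then have gt: "2 * b j < b (Suc j)" if "j < m" for j using that by (auto simp: not_le)
  have "2 ^ j \<le> b j \<and> (0 < j \<longrightarrow> 2 ^ j < b j)" if "j \<le> m" for j
    using that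
  proof (induction j)
    case 0 then show ?case using assms(1) by simp
  next
    case (Suc j)
    then have "2 * 2 ^ j \<le> 2 * b j" by simp
    then show ?case using gt[of j] Suc.prems by simp
  qed
  from this[of m] show False using assms(2,3) by simp
qed

text \<open>
  The non-doubling step is what makes the sizes of the inner and the outer ball comparable, so that
  the Rayleigh quotient only depends on the slope of the cutoff; its price is the factor \<open>m\<close>, of
  order \<open>log\<^sub>2 N\<close>, between the radius and the thickness \<open>s\<close> of a shell.
\<close>

lemma exists_cutoff:
  fixes E :: "'v::finite adj"
  assumes "symp E" "connected_graph E" "1 \<le> s" "1 \<le> m" "CARD('v) \<le> 2 ^ m"
  shows "\<exists>f. f \<noteq> 0 \<and> (\<forall>x. f $ x \<noteq> 0 \<longrightarrow> graph_dist E c x < m * s)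
    \<and> neg_laplacian E f \<bullet> f \<le> 2 * real (max_degree E) / (real s)\<^sup>2 * (f \<bullet> f)"
proof -
  define d where "d = graph_dist E c"
  define b where "b j = card {x. d x \<le> j * s}" for j
  have dc: "d c = 0" by (simp add: d_def graph_dist_self)
  then have b0: "1 \<le> b j" for j
    by (auto simp: b_def Suc_le_eq card_gt_0_iff intro!: exI[of _ c])
  have "b m \<le> 2 ^ m"
    unfolding b_def by (rule order.trans[OF card_mono[OF finite subset_UNIV] assms(5)])
  then obtain j where j: "j < m" "b (Suc j) \<le> 2 * b j"
    using exists_non_doubling_step[of b m] b0 assms(4) by blast
  \<comment> \<open>Truncated subtraction of naturals makes the function vanish outside the outer ball.\<close>
  define f :: "real ^ 'v" where "f = (\<chi> x. real (min s (Suc j * s - d x)))"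
  have f_inner: "f $ x = s" if "d x \<le> j * s" for x
    using that by (simp add: f_def)
  have f_supp: "d x < Suc j * s" if "f $ x \<noteq> 0" for x
    using that by (auto simp: f_def min_def split: if_splits)
  have lip: "\<bar>f $ x - f $ y\<bar> \<le> 1" if "E x y" for x y
  proof -
    have "d x \<le> d y + 1" "d y \<le> d x + 1"
      using graph_dist_triangle[OF assms(2), of c x y] graph_dist_triangle[OF assms(2), of c y x]
        graph_dist_edge[of E x y] graph_dist_edge[of E y x] that sympD[OF assms(1) that]
      unfolding d_def by linarith+
    then have "min s (Suc j * s - d x) \<le> min s (Suc j * s - d y) + 1"
      "min s (Suc j * s - d y) \<le> min s (Suc j * s - d x) + 1" by linarith+
    then show ?thesis unfolding f_def by (simp add: abs_le_iff del: mult_Suc)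
  qed
  have s0: "real s > 0" using assms(3) by simp
  have norm: "(real s)\<^sup>2 * b j \<le> f \<bullet> f"
  proof -
    have "(real s)\<^sup>2 * b j = (\<Sum>x | d x \<le> j * s. f $ x * f $ x)"
      by (simp add: f_inner b_def power2_eq_square)
    also have "\<dots> \<le> (\<Sum>x\<in>UNIV. f $ x * f $ x)" by (rule sum_mono2) auto
    finally show ?thesis by (simp add: inner_vec_def)
  qed
  have "neg_laplacian E f \<bullet> f \<le> real (max_degree E) * real (card {x. f $ x \<noteq> 0})"
    by (rule energy_le_support[OF assms(1) lip])
  also have "\<dots> \<le> real (max_degree E) * (2 * b j)"
  proof -
    have "card {x. f $ x \<noteq> 0} \<le> b (Suc j)"
      unfolding b_def using f_supp by (intro card_mono) (auto dest: less_imp_le)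
    then have "real (card {x. f $ x \<noteq> 0}) \<le> 2 * b j" using j(2) by linarith
    then show ?thesis by (simp add: mult_left_mono)
  qed
  also have "\<dots> = 2 * real (max_degree E) / (real s)\<^sup>2 * ((real s)\<^sup>2 * b j)"
    using s0 by simp
  also have "\<dots> \<le> 2 * real (max_degree E) / (real s)\<^sup>2 * (f \<bullet> f)"
    using norm by (intro mult_left_mono) auto
  finally have "neg_laplacian E f \<bullet> f \<le> 2 * real (max_degree E) / (real s)\<^sup>2 * (f \<bullet> f)" .
  moreover have "f \<noteq> 0"
    using f_inner[of c] dc s0 by auto
  moreover have "d x < m * s" if "f $ x \<noteq> 0" for x
    using f_supp[OF that] j(1) mult_le_mono1[of "Suc j" m s] by linarith
  ultimately show ?thesis unfolding d_def by blast
qed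

lemma separated_supports:
  assumes "symp E" "\<And>x y. f $ x \<noteq> 0 \<Longrightarrow> g $ y \<noteq> 0 \<Longrightarrow> x \<noteq> y \<and> \<not> E x y"
  shows "f \<bullet> g = 0" "neg_laplacian E f \<bullet> g = 0"
proof -
  show "f \<bullet> g = 0"
    using assms(2) by (auto simp: inner_vec_def intro!: sum.neutral) blast
  have "(f $ x - f $ y) * (g $ x - g $ y) = 0" if "E x y" for x y
  proof -
    have "E y x" by (rule sympD[OF assms(1) that])
    then have "f $ x = 0 \<and> f $ y = 0 \<or> g $ x = 0 \<and> g $ y = 0"
      using assms(2) that by blast
    then show ?thesis by auto
  qed
  then show "neg_laplacian E f \<bullet> g = 0"
    unfolding energy[OF assms(1)] by (auto intro!: sum.neutral)
qed

text \<open>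
  The centres are placed on a geodesic at distances \<open>0, 2R, 4R, ...\<close> from its origin. Since the cutoff
  functions live on the open balls of radius \<open>R\<close>, vertices of different supports are at distance at
  least \<open>2\<close>, which rules out edges between the supports as well as overlaps.
\<close>

lemma nth_eigenvalue_le_step:
  fixes E :: "'v::finite adj"
  assumes "symp E" "connected_graph E" "1 \<le> s" "1 \<le> m" "CARD('v) \<le> 2 ^ m" "1 \<le> k"
    and diam: "2 * (m * s) * (k - 1) \<le> graph_diam E"
  shows "nth_eigenvalue E k \<le> 2 * real (max_degree E) / (real s)\<^sup>2"
proof -
  define R where "R = m * s"
  define M where "M = 2 * real (max_degree E) / (real s)\<^sup>2"
  obtain x0 y0 where xy: "graph_dist E x0 y0 = graph_diam E" using graph_diam_attained by blast
  have "\<exists>z. graph_dist E x0 z = 2 * R * i" if "i < k" for i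
  proof -
    have "2 * R * i \<le> 2 * R * (k - 1)" using that by (intro mult_le_mono2) auto
    also have "\<dots> \<le> graph_dist E x0 y0" using diam xy by (simp add: R_def)
    finally show ?thesis by (rule exists_at_distance[OF assms(2)])
  qed
  then obtain c where c: "\<And>i. i < k \<Longrightarrow> graph_dist E x0 (c i) = 2 * R * i" by metis
  have sep: "2 * R \<le> graph_dist E (c i) (c j)" if "i < k" "j < k" "i \<noteq> j" for i j
  proof -
    have *: "2 * R \<le> graph_dist E (c i) (c j)" if "i < j" "j < k" for i j
    proof -
      have "2 * R * j \<le> 2 * R * i + graph_dist E (c i) (c j)"
        using graph_dist_triangle[OF assms(2), of x0 "c j" "c i"] c that by simp
      moreover have "2 * R * Suc i \<le> 2 * R * j" using that by (intro mult_le_mono2) auto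
      ultimately show ?thesis by simp
    qed
    show ?thesis
      using *[of i j] *[of j i] that graph_dist_sym[OF assms(1), of "c i" "c j"] by linarith
  qed
  have "\<exists>F. \<forall>i. F i \<noteq> 0 \<and> (\<forall>x. F i $ x \<noteq> 0 \<longrightarrow> graph_dist E (c i) x < R)
      \<and> neg_laplacian E (F i) \<bullet> F i \<le> M * (F i \<bullet> F i)"
    unfolding R_def M_def by (intro choice allI exists_cutoff[OF assms(1-5)])
  then obtain F where F: "\<And>i. F i \<noteq> 0" "\<And>i x. F i $ x \<noteq> 0 \<Longrightarrow> graph_dist E (c i) x < R"
    "\<And>i. neg_laplacian E (F i) \<bullet> F i \<le> M * (F i \<bullet> F i)"
    by blast
  have far: "x \<noteq> y \<and> \<not> E x y" if "i < k" "j < k" "i \<noteq> j" "F i $ x \<noteq> 0" "F j $ y \<noteq> 0" for i j x y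
  proof -
    have "2 * R \<le> graph_dist E (c i) x + graph_dist E x y + graph_dist E y (c j)"
      using sep[OF that(1-3)] graph_dist_triangle[OF assms(2), of "c i" "c j" x]
        graph_dist_triangle[OF assms(2), of x "c j" y] by linarith
    then have "2 \<le> graph_dist E x y"
      using F(2)[OF that(4)] F(2)[OF that(5)] graph_dist_sym[OF assms(1), of y "c j"] by linarith
    then show ?thesis using graph_dist_edge[of E x y] graph_dist_self[of E x] by auto
  qed
  have orth: "F i \<bullet> F j = 0" "neg_laplacian E (F i) \<bullet> F j = 0" if "i < k" "j < k" "i \<noteq> j" for i j
    using separated_supports[OF assms(1) far[OF that]] by auto
  define B where "B = F ` {..<k}"
  have "inj_on F {..<k}"
    using orth(1) F(1) by (intro inj_onI) (metis inner_eq_zero_iff lessThan_iff)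
  then have "card B = k" by (simp add: B_def card_image)
  moreover have orthB: "u \<bullet> v = 0" "neg_laplacian E u \<bullet> v = 0" if uv: "u \<in> B" "v \<in> B" "u \<noteq> v" for u v
  proof -
    obtain i j where ij: "u = F i" "v = F j" "i < k" "j < k" using uv by (auto simp: B_def)
    then have "i \<noteq> j" using uv(3) by blast
    then show "u \<bullet> v = 0" "neg_laplacian E u \<bullet> v = 0" using orth ij by simp_all
  qed
  moreover have "independent B"
  proof (rule pairwise_orthogonal_independent)
    show "pairwise orthogonal B" using orthB(1) by (simp add: pairwise_def orthogonal_def)
    show "0 \<notin> B" using F(1) by (force simp: B_def)
  qed
  ultimately have dim: "dim (span B) = k" by (simp add: dim_eq_card_independent)
  have "neg_laplacian E f \<bullet> f \<le> M * (f \<bullet> f)" if "f \<in> span B" for f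
  proof (rule self_adjoint.rayleigh_span[OF self_adjoint_neg_laplacian[OF assms(1)] _ _ _ _ that])
    show "finite B" by (simp add: B_def)
    show "u \<bullet> v = 0" if "u \<in> B" "v \<in> B" "u \<noteq> v" for u v
      using that by (rule orthB(1))
    show "neg_laplacian E u \<bullet> v = 0" if "u \<in> B" "v \<in> B" "u \<noteq> v" for u v
      using that by (rule orthB(2))
    show "neg_laplacian E u \<bullet> u \<le> M * (u \<bullet> u)" if "u \<in> B" for u
      using that F(3) by (auto simp: B_def)
  qed
  then have "nth_eigenvalue E k \<le> M"
    by (rule nth_eigenvalue_le(2)[OF assms(1) subspace_span assms(6) eq_refl[OF dim[symmetric]]])
  then show ?thesis by (simp add: M_def)
qed

section \<open>The diameter bound\<close>

text \<open>
  The shell thickness \<open>s\<close> is the largest integer for which \<open>k\<close> separated balls of radius \<open>m * s\<close> fit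
  along a geodesic of length \<open>D\<close>. One factor \<open>2\<close> of the constant \<open>8\<close> comes from the separation
  \<open>2 R\<close> of the centres, the other two from rounding: \<open>m \<le> 2 log\<^sub>2 N\<close>, and \<open>s + 1 \<le> 2 s\<close> for \<open>s \<ge> 1\<close>.
\<close>

lemma diam_mult_sqrt_eigenvalue_le:
  fixes E :: "'v::finite adj"
  assumes "symp E" "connected_graph E" "2 \<le> k" "k \<le> CARD('v)"
  shows "graph_diam E * sqrt (nth_eigenvalue E k)
    \<le> 8 * k * sqrt (2 * real (max_degree E)) * log 2 CARD('v)"
proof -
  define N where "N = CARD('v)"
  define D where "D = graph_diam E"
  define lam where "lam = nth_eigenvalue E k"
  define r where "r = sqrt (2 * real (max_degree E))"
  define m where "m = nat \<lceil>log 2 N\<rceil>"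
  define s where "s = D div (2 * m * (k - 1))"
  have N2: "2 \<le> N" using assms unfolding N_def by linarith
  have log1: "1 \<le> log 2 N" using N2 by (simp add: le_log_iff)
  have r0: "0 \<le> r" by (simp add: r_def)
  have m1: "1 \<le> m" using log1 unfolding m_def by linarith
  have mlog: "log 2 N \<le> m" "m \<le> 2 * log 2 N" using log1 unfolding m_def by linarith+
  have "real N \<le> 2 powr m" using mlog(1) N2 by (simp add: log_le_iff)
  then have "real N \<le> real (2 ^ m)" by (simp add: powr_realpow)
  then have Nm: "N \<le> 2 ^ m" by (simp only: of_nat_le_iff)
  have den: "0 < 2 * m * (k - 1)" using m1 assms(3) by simp
  have kk: "real (2 * m * (k - 1)) \<le> 4 * k * log 2 N"
  proof -
    have "real (2 * m * (k - 1)) \<le> real (2 * m * k)" unfolding of_nat_le_iff by simp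
    also have "\<dots> \<le> 4 * k * log 2 N" using mult_left_mono[OF mlog(2), of "2 * real k"] by simp
    finally show ?thesis .
  qed
  have Ds: "real D \<le> (s + 1) * (4 * k * log 2 N)"
  proof -
    have "D \<le> (s + 1) * (2 * m * (k - 1))"
      using dividend_less_div_times[OF den, of D] by (simp add: s_def algebra_simps)
    then have "real D \<le> (s + 1) * real (2 * m * (k - 1))"
      by (metis of_nat_le_iff of_nat_mult)
    also have "\<dots> \<le> (s + 1) * (4 * k * log 2 N)" using kk by (intro mult_left_mono) auto
    finally show ?thesis .
  qed
  have sr: "(s + 1) * sqrt lam \<le> 2 * r"
  proof (cases "s = 0")
    case True
    have "lam \<le> 2 * real (max_degree E)"
      unfolding lam_def using assms energy_le_max_degree[OF assms(1)]
      by (intro nth_eigenvalue_le(2)[OF assms(1) subspace_UNIV]) (auto simp: dim_UNIV)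
    then have "sqrt lam \<le> r" by (simp add: r_def)
    then show ?thesis using True r0 by simp
  next
    case False
    have "2 * (m * s) * (k - 1) \<le> D"
      using div_times_less_eq_dividend[of D "2 * m * (k - 1)"] by (simp add: s_def mult_ac)
    then have "lam \<le> 2 * real (max_degree E) / (real s)\<^sup>2"
      unfolding lam_def D_def using False m1 Nm assms N_def
      by (intro nth_eigenvalue_le_step[OF assms(1,2)]) auto
    then have "sqrt lam \<le> sqrt (2 * real (max_degree E) / (real s)\<^sup>2)"
      by (rule real_sqrt_le_mono)
    then have "sqrt lam \<le> r / s" by (simp add: r_def real_sqrt_divide)
    then have "s * sqrt lam \<le> r" using False by (simp add: field_simps)
    moreover have "(s + 1) * sqrt lam \<le> 2 * s * sqrt lam" if "0 \<le> sqrt lam"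
      using False that by (intro mult_right_mono) auto
    moreover have "(s + 1) * sqrt lam \<le> 0" if "sqrt lam \<le> 0"
      using that by (simp add: mult_nonneg_nonpos)
    ultimately show ?thesis using r0 by linarith
  qed
  have lam0: "0 \<le> sqrt lam"
  proof -
    have "k \<le> length (eigenvalue_list E)"
      using card_le_length_eigenvalue_list[OF assms(1)] assms(4) by linarith
    then show ?thesis using nth_eigenvalue_pos[OF assms(1-3)] by (simp add: lam_def)
  qed
  have "D * sqrt lam \<le> (s + 1) * (4 * k * log 2 N) * sqrt lam"
    using Ds lam0 by (intro mult_right_mono) auto
  also have "\<dots> = 4 * k * log 2 N * ((s + 1) * sqrt lam)" by simp
  also have "\<dots> \<le> 4 * k * log 2 N * (2 * r)"
    using sr log1 by (intro mult_left_mono) auto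
  finally show ?thesis by (simp add: D_def lam_def N_def r_def mult_ac)
qed

theorem corollaryD:
  fixes E :: "'v::finite \<Rightarrow> 'v \<Rightarrow> bool" and k :: nat
  assumes "symp E" and "irreflp E" and "connected_graph E"
    and "CD_0_infinity E"
    and "2 \<le> k" and "k \<le> CARD('v)"
  shows "real (graph_diam E)
    \<le> 80 * exp 1 / (exp 1 - 1) * real (max_degree E) * log 2 (real CARD('v))
        * (real k / sqrt (nth_eigenvalue E k))"
proof -
  define d where "d = real (max_degree E)"
  define q where "q = exp 1 / (exp 1 - 1 :: real)"
  have "k \<le> length (eigenvalue_list E)"
    using card_le_length_eigenvalue_list[OF assms(1)] assms(6) by linarith
  then have pos: "0 < sqrt (nth_eigenvalue E k)"
    using nth_eigenvalue_pos assms by simp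
  have "sqrt (2 * d) \<le> 2 * d"
  proof (cases "max_degree E = 0")
    case False
    then have "1 \<le> 2 * d" by (simp add: d_def)
    then have "2 * d \<le> (2 * d)\<^sup>2" by (rule self_le_power) simp
    then show ?thesis by (simp add: real_le_lsqrt d_def)
  qed (simp add: d_def)
  have "1 \<le> q" unfolding q_def by (simp add: le_divide_eq)
  have L0: "0 \<le> log 2 (real CARD('v))" using assms by simp
  have "graph_diam E * sqrt (nth_eigenvalue E k) \<le> 8 * k * sqrt (2 * d) * log 2 CARD('v)"
    using diam_mult_sqrt_eigenvalue_le assms by (simp add: d_def)
  also have "\<dots> \<le> 8 * k * (2 * d) * log 2 CARD('v)"
    using \<open>sqrt (2 * d) \<le> 2 * d\<close> L0 by (intro mult_right_mono mult_left_mono) auto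
  also have "\<dots> = 16 * (d * log 2 CARD('v) * k)" by simp
  also have "\<dots> \<le> 80 * q * (d * log 2 CARD('v) * k)"
    using \<open>1 \<le> q\<close> L0 by (intro mult_right_mono) (auto simp: d_def)
  finally show ?thesis
    using pos by (simp add: q_def d_def pos_le_divide_eq mult_ac)
qed

end
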